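(* Suppose that $f(z) = \sum_{k=0}^\infty a_k z^k$ is analytic in $\mathbb{D}$ and $|f(z)| \leq 1$ in $\mathbb{D}$. Then $$M(z,r):=|f(z)|^2+\sum_{k=1}^\infty |a_k|r^k+\frac{16}{9}\left(\frac{S_r}{\pi}\right)+\lambda\left(\frac{S_r}{\pi}\right)^2 \leq 1 \quad\text{for } |z| = r \leq \frac{1}{3},$$ where $$\lambda=\frac{-81 + 1044 a + 54 a^2 - 116 a^3 - 5 a^4}{162 (a+1)^2 (2 a-1)}=16.4618 \ldots$$ and $a\approx 0.537869$ is the unique positive root of the equation $$-513 + 910 t + 80 t^2 + 2 t^3 + t^4=0$$ in the interval $(0,1)$. The equality is achieved for the function $$f(z) = \frac{a-z}{1-az}.$$
   Context: $\mathbb{D}=\{z\in\mathbb{C}: |z|<1\}$ is the open unit disk. For $f(z)=\sum_{k=0}^\infty a_kz^k$ analytic in $\mathbb{D}$, $S_r=S_r(f)$ denotes the area of the image of the subdisk $|z|<r$ under the mapping $f$, with the convention $\dfrac{S_r}{\pi}=\sum_{k=1}^\infty k|a_k|^2r^{2k}$ (area counted with multiplicity). *)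

theory Defs
  imports "HOL-Complex_Analysis.Complex_Analysis"
begin

definition taylor_coeff :: "(complex \<Rightarrow> complex) \<Rightarrow> nat \<Rightarrow> complex" where
  "taylor_coeff f k = fps_nth (fps_expansion f 0) k"

(* The area, counted with multiplicity, of the image of the disk |z| < r under f, given by
     S_r / pi = (SUM k >= 1. k |a_k|^2 r^(2k)).
   The index is shifted so that the sum starts at k = 1.  The series converges whenever f is
   analytic in the unit disk and 0 <= r < 1. *)
definition image_area :: "(complex \<Rightarrow> complex) \<Rightarrow> real \<Rightarrow> real" where
  "image_area f r =
     pi * (\<Sum>k. real (Suc k) * (cmod (taylor_coeff f (Suc k)))\<^sup>2 * r ^ (2 * Suc k))"

definition crit_poly :: "real \<Rightarrow> real" where
  "crit_poly t = -513 + 910 * t + 80 * t ^ 2 + 2 * t ^ 3 + t ^ 4"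

(* Meaningful because the root exists and is unique, which is part of the theorem. *)
definition crit_a :: real where
  "crit_a = (THE t. 0 < t \<and> t < 1 \<and> crit_poly t = 0)"

definition lambda_of :: "real \<Rightarrow> real" where
  "lambda_of a =
     (-81 + 1044 * a + 54 * a ^ 2 - 116 * a ^ 3 - 5 * a ^ 4) / (162 * (a + 1) ^ 2 * (2 * a - 1))"

definition bohr_M :: "(complex \<Rightarrow> complex) \<Rightarrow> complex \<Rightarrow> real \<Rightarrow> real" where
  "bohr_M f z r =
     (cmod (f z))\<^sup>2 + (\<Sum>k. cmod (taylor_coeff f (Suc k)) * r ^ Suc k)
       + 16 / 9 * (image_area f r / pi) + lambda_of crit_a * (image_area f r / pi)\<^sup>2"

definition extremal_f :: "real \<Rightarrow> complex \<Rightarrow> complex" where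
  "extremal_f a z = (of_real a - z) / (1 - of_real a * z)"

end

theory Submission
  imports Defs
begin

text \<open>
  Write \<open>a = |f 0|\<close> and \<open>f - f 0 = g (1 - cnj (f 0) f)\<close> with \<open>|g| \<le> 1\<close> and \<open>g 0 = 0\<close>.  The coefficients
  of \<open>f\<close> up to degree \<open>n\<close> only involve those of \<open>1 - cnj (f 0) f\<close> up to degree \<open>n - 1\<close>, and multiplication
  by \<open>g\<close> contracts the Hardy norm, so \<open>T n = (\<Sum>k=1..n. |a k|\<^sup>2)\<close> satisfies
  \<open>T n \<le> (1 - a\<^sup>2)\<^sup>2 + a\<^sup>2 T (n - 1)\<close>: every \<open>T n\<close> is at most its value for the disk automorphism.
  Summation by parts turns this into the sharp bound for the area and, with Cauchy--Schwarz, for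
  \<open>\<Sum> |a k| r ^ k\<close> when \<open>r \<le> a\<close>.  Together with the Schwarz--Pick bound for \<open>|f z|\<close>, everything is then
  dominated by its value for the automorphism at \<open>r = 1 / 3\<close>, where \<open>M \<le> 1\<close> says that \<open>\<lambda>\<close> is at most an
  explicit rational function of \<open>a\<close>; its derivative has the sign of \<open>crit_poly\<close>.  For \<open>a < 1 / 3\<close>
  the cruder bound \<open>T n \<le> 1 - a\<^sup>2\<close> leaves enough room.
\<close>

subsection \<open>Coefficients of bounded functions\<close>

lemma has_fps_expansion_taylor:
  assumes "f holomorphic_on ball 0 1"
  shows "f has_fps_expansion fps_expansion f 0"
  using assms by (intro has_fps_expansion_fps_expansion[of "ball 0 1"]) auto

lemma taylor_coeff_eqI:
  assumes "f has_fps_expansion F"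
  shows "taylor_coeff f k = fps_nth F k"
  unfolding taylor_coeff_def using fps_expansion_eqI[OF assms] by simp

section \<open>Fourier coefficients and Parseval on circles inside the disk\<close>

definition circ :: "real \<Rightarrow> complex" where
  "circ t = exp (2 * of_real pi * \<i> * of_real t)"

lemma circ_cnj: "circ t * cnj (circ t) = 1"
  by (simp add: circ_def exp_cnj flip: exp_add)

lemma norm_circ [simp]: "cmod (circ t) = 1"
  by (simp add: circ_def)

lemma continuous_on_circ [continuous_intros]: "continuous_on S circ"
  unfolding circ_def by (intro continuous_intros)

text \<open>Cauchy's formula for the \<open>k\<close>-th derivative on the circle of radius
  \<open>R\<close>. The parameter interval has length 1, as for \<open>circlepath\<close>, so the
  left side is a Fourier coefficient without a normalising factor.\<close>

lemma has_integral_taylor_coeff: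
  assumes h: "h holomorphic_on ball 0 1" and R: "0 < R" "R < 1"
  shows "((\<lambda>t. h (of_real R * circ t) * cnj (circ t ^ k)) has_integral
           taylor_coeff h k * of_real R ^ k) {0..1}"
proof -
  have "((\<lambda>u. h u / (u - 0) ^ Suc k) has_contour_integral
      (2 * pi * \<i>) / fact k * (deriv ^^ k) h 0) (circlepath 0 R)"
    using R by (intro Cauchy_has_contour_integral_higher_derivative_circlepath)
      (auto intro!: holomorphic_on_imp_continuous_on holomorphic_on_subset[OF h])
  then have "((\<lambda>t. h (of_real R * circ t) / (of_real R * circ t) ^ Suc k *
      (2 * pi * \<i> * of_real R * circ t)) has_integral
      (2 * pi * \<i>) / fact k * (deriv ^^ k) h 0) {0..1}"
    unfolding has_contour_integral_def
  proof (rule has_integral_eq[rotated])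
    fix t :: real assume t: "t \<in> {0..1}"
    have "circlepath 0 R t = of_real R * circ t"
      by (simp add: circlepath circ_def)
    moreover have "vector_derivative (circlepath 0 R) (at t within {0..1}) = 2 * pi * \<i> * of_real R * circ t"
      using t by (subst vector_derivative_circlepath01) (auto simp: circ_def)
    ultimately show "h (circlepath 0 R t) / (circlepath 0 R t - 0) ^ Suc k *
        vector_derivative (circlepath 0 R) (at t within {0..1}) =
        h (of_real R * circ t) / (of_real R * circ t) ^ Suc k * (2 * pi * \<i> * of_real R * circ t)"
      by simp
  qed
  then have *: "((\<lambda>t. (of_real R ^ k / (2 * pi * \<i>)) * (h (of_real R * circ t) / (of_real R * circ t) ^ Suc k *
      (2 * pi * \<i> * of_real R * circ t))) has_integral
      (of_real R ^ k / (2 * pi * \<i>)) * ((2 * pi * \<i>) / fact k * (deriv ^^ k) h 0)) {0..1}"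
    by (rule has_integral_mult_right)
  have eq: "(of_real R ^ k / (2 * pi * \<i>)) * (h (of_real R * circ t) / (of_real R * circ t) ^ Suc k *
      (2 * pi * \<i> * of_real R * circ t)) = h (of_real R * circ t) * cnj (circ t ^ k)" for t
  proof -
    have nz: "circ t \<noteq> 0" using circ_cnj[of t] by auto
    then have "cnj (circ t) = inverse (circ t)"
      using circ_cnj[of t] by (simp add: field_simps)
    moreover have "circ t ^ k * cnj (circ t) ^ k = 1"
      by (simp add: circ_cnj flip: power_mult_distrib)
    ultimately show ?thesis using nz R
      by (simp add: field_simps power_mult_distrib power_inverse)
  qed
  have "(of_real R ^ k / (2 * pi * \<i>)) * ((2 * pi * \<i>) / fact k * (deriv ^^ k) h 0)
      = taylor_coeff h k * of_real R ^ k"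
    by (simp add: taylor_coeff_def fps_expansion_def field_simps)
  with * show ?thesis by (simp only: eq)
qed

text \<open>Cauchy's formula for the monomial \<open>z ^ k\<close>. The radius 1/2 is arbitrary in
  (0,1), and the factor \<open>2 ^ k\<close> undoes it.\<close>

lemma circ_orthonormal:
  "((\<lambda>t. circ t ^ k * cnj (circ t ^ j)) has_integral (if j = k then 1 else 0)) {0..1}"
proof -
  have "(\<lambda>z::complex. z ^ k) has_fps_expansion fps_X ^ k"
    by (intro fps_expansion_intros)
  then have tc: "taylor_coeff (\<lambda>z. z ^ k) j = (if j = k then 1 else 0)"
    by (simp add: taylor_coeff_eqI)
  have "((\<lambda>t. 2 ^ k * ((of_real (1/2) * circ t) ^ k * cnj (circ t ^ j))) has_integral
      2 ^ k * (taylor_coeff (\<lambda>z. z ^ k) j * of_real (1/2) ^ j)) {0..1}"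
    by (intro has_integral_mult_right has_integral_taylor_coeff holomorphic_intros) auto
  then show ?thesis
    by (auto simp: tc power_mult_distrib power_divide split: if_splits)
qed

lemma has_integral_trig_cnj:
  "((\<lambda>t. (\<Sum>i<n. c i * circ t ^ i) * cnj (circ t ^ k)) has_integral
     (if k < n then c k else 0)) {0..1}"
proof -
  have "((\<lambda>t. \<Sum>i<n. c i * (circ t ^ i * cnj (circ t ^ k))) has_integral
      (\<Sum>i<n. c i * (if k = i then 1 else 0))) {0..1}"
    by (intro has_integral_sum has_integral_mult_right circ_orthonormal) auto
  moreover have "(\<Sum>i<n. c i * (if k = i then 1 else 0)) = (if k < n then c k else 0)"
    by (simp add: if_distrib cong: if_cong)
  ultimately show ?thesis by (simp only: sum_distrib_right mult.assoc)
qed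

text \<open>Expanding the square, the cross term and the square of the Fourier partial sum both
  reduce to the sum of |c k|^2. Nonnegativity of the integral is Bessel's inequality; if
  \<open>F\<close> equals its partial sum, the integral is 0 and Parseval's identity
  results.\<close>

lemma parseval_defect:
  assumes F: "continuous_on {0..1} F"
    and c: "\<And>k. k < n \<Longrightarrow> ((\<lambda>t. F t * cnj (circ t ^ k)) has_integral c k) {0..1}"
  shows "((\<lambda>t. (cmod (F t - (\<Sum>k<n. c k * circ t ^ k)))\<^sup>2) has_integral
           integral {0..1} (\<lambda>t. (cmod (F t))\<^sup>2) - (\<Sum>k<n. (cmod (c k))\<^sup>2)) {0..1}"
proof -
  define g where "g t = (\<Sum>k<n. c k * circ t ^ k)" for t
  \<comment> \<open>Only the coefficients of \<open>H\<close> below \<open>n\<close> matter, so this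
    serves both for \<open>F\<close> and for its partial sum \<open>g\<close>.\<close>
  have proj: "((\<lambda>t. Re (H t * cnj (g t))) has_integral (\<Sum>k<n. (cmod (c k))\<^sup>2)) {0..1}"
    if H: "\<And>k. k < n \<Longrightarrow> ((\<lambda>t. H t * cnj (circ t ^ k)) has_integral c k) {0..1}" for H
  proof -
    have "((\<lambda>t. \<Sum>k<n. cnj (c k) * (H t * cnj (circ t ^ k))) has_integral
        (\<Sum>k<n. cnj (c k) * c k)) {0..1}"
      by (intro has_integral_sum has_integral_mult_right H) auto
    moreover have "(\<Sum>k<n. cnj (c k) * (H t * cnj (circ t ^ k))) = H t * cnj (g t)" for t
      by (simp add: g_def sum_distrib_left mult_ac)
    moreover have "(\<Sum>k<n. cnj (c k) * c k) = of_real (\<Sum>k<n. (cmod (c k))\<^sup>2)"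
      by (simp add: complex_norm_square mult.commute del: of_real_power)
    ultimately have "((\<lambda>t. H t * cnj (g t)) has_integral of_real (\<Sum>k<n. (cmod (c k))\<^sup>2)) {0..1}"
      by simp
    from has_integral_linear[OF this bounded_linear_Re]
    show ?thesis by (simp add: o_def)
  qed
  have FF: "((\<lambda>t. (cmod (F t))\<^sup>2) has_integral integral {0..1} (\<lambda>t. (cmod (F t))\<^sup>2)) {0..1}"
    by (intro integrable_integral integrable_continuous_interval continuous_intros F)
  have Fg: "((\<lambda>t. Re (F t * cnj (g t))) has_integral (\<Sum>k<n. (cmod (c k))\<^sup>2)) {0..1}"
    by (rule proj) (rule c)
  have gg: "((\<lambda>t. Re (g t * cnj (g t))) has_integral (\<Sum>k<n. (cmod (c k))\<^sup>2)) {0..1}"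
  proof (rule proj)
    fix k assume "k < n"
    then show "((\<lambda>t. g t * cnj (circ t ^ k)) has_integral c k) {0..1}"
      using has_integral_trig_cnj[where n = n and c = c and k = k] by (simp add: g_def)
  qed
  have "(cmod (F t))\<^sup>2 - 2 * Re (F t * cnj (g t)) + Re (g t * cnj (g t)) = (cmod (F t - g t))\<^sup>2" for t
    unfolding cmod_power2 by (simp add: power2_eq_square algebra_simps)
  with has_integral_add[OF has_integral_diff[OF FF has_integral_mult_right[OF Fg, of 2]] gg]
  show ?thesis by (simp add: g_def)
qed

text \<open>Multiplication by a function bounded by 1 does not increase the Hardy norm.\<close>

lemma sum_taylor_coeff_dominated:
  assumes h: "h holomorphic_on ball 0 1"
    and le: "\<And>z. cmod z < 1 \<Longrightarrow> cmod (h z) \<le> cmod (\<Sum>k<n. p k * z ^ k)"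
  shows "(\<Sum>k<m. (cmod (taylor_coeff h k))\<^sup>2) \<le> (\<Sum>k<n. (cmod (p k))\<^sup>2)"
proof -
  have R: "(\<Sum>k<m. (cmod (taylor_coeff h k * of_real R ^ k))\<^sup>2) \<le> (\<Sum>k<n. (cmod (p k * of_real R ^ k))\<^sup>2)"
    if R: "0 < R" "R < 1" for R
  proof -
    define H where "H t = h (of_real R * circ t)" for t
    define P where "P t = (\<Sum>k<n. (p k * of_real R ^ k) * circ t ^ k)" for t
    have cH: "continuous_on {0..1} H" unfolding H_def using R
      by (intro continuous_on_compose2[OF holomorphic_on_imp_continuous_on[OF h]] continuous_intros)
        (auto simp: norm_mult)
    have cP: "continuous_on {0..1} P" unfolding P_def by (intro continuous_intros)
    \<comment> \<open>Bessel's inequality for \<open>H\<close>.\<close>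
    have "(\<Sum>k<m. (cmod (taylor_coeff h k * of_real R ^ k))\<^sup>2) \<le> integral {0..1} (\<lambda>t. (cmod (H t))\<^sup>2)"
      using has_integral_nonneg[OF parseval_defect[OF cH, where n = m and c = "\<lambda>k. taylor_coeff h k * of_real R ^ k"]]
        has_integral_taylor_coeff[OF h R] by (simp add: H_def)
    also have "\<dots> \<le> integral {0..1} (\<lambda>t. (cmod (P t))\<^sup>2)"
    proof (rule integral_le)
      fix t :: real assume "t \<in> {0..1}"
      have "cmod (H t) \<le> cmod (P t)"
        using le[of "of_real R * circ t"] R
        by (simp add: H_def P_def norm_mult power_mult_distrib mult_ac)
      then show "(cmod (H t))\<^sup>2 \<le> (cmod (P t))\<^sup>2" by (simp add: power_mono)
    qed (intro integrable_continuous_interval continuous_intros cH cP)+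
    \<comment> \<open>\<open>P\<close> is its own partial sum, so its defect vanishes.\<close>
    also have "\<dots> = (\<Sum>k<n. (cmod (p k * of_real R ^ k))\<^sup>2)"
    proof -
      have "((\<lambda>t. (cmod (P t - (\<Sum>k<n. (p k * of_real R ^ k) * circ t ^ k)))\<^sup>2) has_integral
           integral {0..1} (\<lambda>t. (cmod (P t))\<^sup>2) - (\<Sum>k<n. (cmod (p k * of_real R ^ k))\<^sup>2)) {0..1}"
      proof (rule parseval_defect[OF cP])
        fix k assume "k < n"
        then show "((\<lambda>t. P t * cnj (circ t ^ k)) has_integral p k * of_real R ^ k) {0..1}"
          using has_integral_trig_cnj[where n = n and c = "\<lambda>k. p k * of_real R ^ k" and k = k] by (simp add: P_def)
      qed
      then have "((\<lambda>t. 0::real) has_integral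
           integral {0..1} (\<lambda>t. (cmod (P t))\<^sup>2) - (\<Sum>k<n. (cmod (p k * of_real R ^ k))\<^sup>2)) {0..1}"
        by (simp add: P_def)
      then show ?thesis using has_integral_unique[OF _ has_integral_0] by fastforce
    qed
    finally show ?thesis .
  qed
  \<comment> \<open>The hypotheses control \<open>h\<close> only in the open disk; letting
    \<open>R\<close> tend to 1 from below removes the powers of \<open>R\<close>.\<close>
  have "((\<lambda>R. \<Sum>k<m. (cmod (taylor_coeff h k * of_real R ^ k))\<^sup>2) \<longlongrightarrow>
      (\<Sum>k<m. (cmod (taylor_coeff h k * of_real 1 ^ k))\<^sup>2)) (at_left 1)"
    "((\<lambda>R. \<Sum>k<n. (cmod (p k * of_real R ^ k))\<^sup>2) \<longlongrightarrow>
      (\<Sum>k<n. (cmod (p k * of_real 1 ^ k))\<^sup>2)) (at_left 1)"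
    by (intro tendsto_intros)+
  moreover have "eventually (\<lambda>R. 0 < R \<and> R < 1) (at_left (1::real))"
    by (rule eventually_at_leftI[of 0]) auto
  then have "eventually (\<lambda>R. (\<Sum>k<m. (cmod (taylor_coeff h k * of_real R ^ k))\<^sup>2)
      \<le> (\<Sum>k<n. (cmod (p k * of_real R ^ k))\<^sup>2)) (at_left (1::real))"
    by eventually_elim (use R in blast)
  ultimately have "(\<Sum>k<m. (cmod (taylor_coeff h k * of_real 1 ^ k))\<^sup>2)
      \<le> (\<Sum>k<n. (cmod (p k * of_real 1 ^ k))\<^sup>2)"
    by (intro tendsto_le[OF trivial_limit_at_left_real]) auto
  then show ?thesis by simp
qed


text \<open>Abel summation as an induction: the invariant keeps the boundary term
  \<open>c n * D n\<close>, nonnegative by the hypothesis on partial sums, and lowering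
  \<open>c n\<close> to \<open>c (Suc n)\<close> can only decrease it.\<close>

lemma weighted_sum_mono:
  fixes c x y :: "nat \<Rightarrow> real"
  assumes le: "\<And>n. (\<Sum>k<n. x k) \<le> (\<Sum>k<n. y k)"
    and c: "decseq c" "\<And>n. 0 \<le> c n"
  shows "(\<Sum>k<n. c k * x k) \<le> (\<Sum>k<n. c k * y k)"
proof -
  define D where "D n = (\<Sum>k<n. y k - x k)" for n
  have D0: "0 \<le> D n" for n using le[of n] by (simp add: D_def sum_subtractf)
  have "c n * D n \<le> (\<Sum>k<n. c k * (y k - x k))"
  proof (induction n)
    case 0
    show ?case by (simp add: D_def)
  next
    case (Suc n)
    have "c (Suc n) * D (Suc n) \<le> c n * D (Suc n)"
      using c(1) D0 by (intro mult_right_mono) (auto simp: decseq_Suc_iff)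
    also have "\<dots> = c n * D n + c n * (y n - x n)" by (simp add: D_def algebra_simps)
    also have "\<dots> \<le> (\<Sum>k<Suc n. c k * (y k - x k))" using Suc.IH by simp
    finally show ?case .
  qed
  moreover have "0 \<le> c n * D n" using D0 c(2) by simp
  ultimately have "0 \<le> (\<Sum>k<n. c k * (y k - x k))" by linarith
  then show ?thesis by (simp add: right_diff_distrib sum_subtractf)
qed

subsection \<open>The extremal parameter\<close>

lemma crit_poly_strict_mono:
  assumes "0 \<le> s" "s < t"
  shows "crit_poly s < crit_poly t"
proof -
  have "s ^ 2 \<le> t ^ 2" "s ^ 3 \<le> t ^ 3" "s ^ 4 \<le> t ^ 4"
    using assms by (auto intro!: power_mono)
  then show ?thesis using assms(2) unfolding crit_poly_def by linarith
qed

lemma crit_poly_root: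
  obtains t where "537869054 / 10 ^ 9 < t" "t < 537869055 / 10 ^ 9" "crit_poly t = 0"
proof -
  \<comment> \<open>The bracket is narrow enough that the numerical bounds on lambda survive
    evaluating different factors at different ends.\<close>
  define l h :: real where "l = 537869054 / 10 ^ 9" and "h = 537869055 / 10 ^ 9"
  have neg: "crit_poly l < 0" and pos: "0 < crit_poly h"
    by (simp_all add: crit_poly_def l_def h_def power_divide)
  have "continuous_on {l..h} crit_poly"
    unfolding crit_poly_def[abs_def] by (intro continuous_intros)
  moreover have "l \<le> h" by (simp add: l_def h_def)
  ultimately obtain t where t: "l \<le> t" "t \<le> h" "crit_poly t = 0"
    using IVT'[of crit_poly l 0 h] neg pos by auto
  moreover have "t \<noteq> l" "t \<noteq> h" using t(3) neg pos by auto
  ultimately show ?thesis by (intro that[of t]) (simp_all add: l_def h_def)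
qed

lemma crit_poly_unique_root: "\<exists>!t. 0 < t \<and> t < 1 \<and> crit_poly t = 0"
proof -
  obtain t where t: "537869054 / 10 ^ 9 < t" "t < 537869055 / 10 ^ 9" "crit_poly t = 0"
    by (rule crit_poly_root)
  show ?thesis
  proof (rule ex1I[of _ t])
    show "0 < t \<and> t < 1 \<and> crit_poly t = 0" using t by simp
    fix s assume "0 < s \<and> s < 1 \<and> crit_poly s = 0"
    then show "s = t"
      using crit_poly_strict_mono[of s t] crit_poly_strict_mono[of t s] t
      by (cases s t rule: linorder_cases) auto
  qed
qed

lemma crit_a_bounds: "537869054 / 10 ^ 9 < crit_a" "crit_a < 537869055 / 10 ^ 9"
  and crit_poly_crit_a: "crit_poly crit_a = 0"
proof -
  obtain t where t: "537869054 / 10 ^ 9 < t" "t < 537869055 / 10 ^ 9" "crit_poly t = 0"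
    by (rule crit_poly_root)
  have "crit_a = t"
    unfolding crit_a_def by (rule the1_equality[OF crit_poly_unique_root]) (use t in simp)
  with t show "537869054 / 10 ^ 9 < crit_a" "crit_a < 537869055 / 10 ^ 9" "crit_poly crit_a = 0"
    by simp_all
qed

lemma crit_a_root: "0 < crit_a" "crit_a < 1" "crit_poly crit_a = 0"
  using crit_a_bounds crit_poly_crit_a by simp_all

text \<open>The largest coefficient of \<open>(S / pi)\<^sup>2\<close> that the automorphism with parameter \<open>t\<close>
  admits at \<open>r = 1 / 3\<close>; \<open>lambda_of crit_a\<close> is its minimum.\<close>

definition admissible :: "real \<Rightarrow> real" where
  "admissible t = (t + 29) * (9 - t\<^sup>2)\<^sup>2 / (81 * (1 - t) * (1 + t) ^ 3)"

text \<open>The origin of \<open>crit_poly\<close>: it is what remains of the quotient rule's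
  numerator once a factor positive on [0,1) is removed.\<close>

lemma DERIV_admissible:
  assumes "0 \<le> t" "t < 1"
  shows "(admissible has_real_derivative
    81 * (9 - t\<^sup>2) * (1 + t)\<^sup>2 * crit_poly t / (81 * (1 - t) * (1 + t) ^ 3)\<^sup>2) (at t)"
proof -
  define m where "m = 9 - t\<^sup>2"
  have nz: "81 * (1 - t) * (1 + t) ^ 3 \<noteq> 0" using assms by simp
  have "((\<lambda>t. (t + 29) * (9 - t\<^sup>2)\<^sup>2) has_real_derivative m * (m - 4 * t * (t + 29))) (at t)"
    by (auto intro!: derivative_eq_intros simp: m_def power2_eq_square algebra_simps)
  moreover have "((\<lambda>t. 81 * (1 - t) * (1 + t) ^ 3) has_real_derivative 81 * (1 + t)\<^sup>2 * (2 - 4 * t)) (at t)"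
    by (auto intro!: derivative_eq_intros simp: power2_eq_square power3_eq_cube algebra_simps)
  ultimately have "(admissible has_real_derivative
      (m * (m - 4 * t * (t + 29)) * (81 * (1 - t) * (1 + t) ^ 3)
        - (t + 29) * (9 - t\<^sup>2)\<^sup>2 * (81 * (1 + t)\<^sup>2 * (2 - 4 * t)))
      / (81 * (1 - t) * (1 + t) ^ 3 * (81 * (1 - t) * (1 + t) ^ 3))) (at t)"
    unfolding admissible_def[abs_def] using nz by (rule DERIV_divide)
  moreover have "m * (m - 4 * t * (t + 29)) * (81 * (1 - t) * (1 + t) ^ 3)
        - (t + 29) * (9 - t\<^sup>2)\<^sup>2 * (81 * (1 + t)\<^sup>2 * (2 - 4 * t))
      = 81 * m * (1 + t)\<^sup>2 * ((m - 4 * t * (t + 29)) * (1 - t) * (1 + t) - (t + 29) * m * (2 - 4 * t))"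
    unfolding m_def[symmetric] by (simp add: power2_eq_square power3_eq_cube algebra_simps)
  moreover have "(m - 4 * t * (t + 29)) * (1 - t) * (1 + t) - (t + 29) * m * (2 - 4 * t) = crit_poly t"
    unfolding m_def crit_poly_def by (simp add: eval_nat_numeral algebra_simps)
  ultimately show ?thesis by (simp only: m_def power2_eq_square[of "81 * _ * _"])
qed

text \<open>\<open>crit_poly\<close> increases through its zero at \<open>crit_a\<close>, so
  \<open>admissible\<close> falls up to that point and rises after it.\<close>

lemma admissible_min:
  assumes "0 \<le> t" "t < 1"
  shows "admissible crit_a \<le> admissible t"
proof -
  have nonneg: "0 \<le> 81 * (9 - x\<^sup>2) * (1 + x)\<^sup>2" if "0 \<le> x" "x < 1" for x :: real
    using that by (simp add: abs_square_le_1 order_trans[of _ 1])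
  show ?thesis
  proof (cases "t \<le> crit_a")
    case True
    then show ?thesis
    proof (rule DERIV_nonpos_imp_nonincreasing)
      fix x assume x: "t \<le> x" "x \<le> crit_a"
      then have x': "0 \<le> x" "x < 1" using assms crit_a_root by auto
      have "crit_poly x \<le> 0" using x x' crit_poly_strict_mono[of x crit_a] crit_a_root
        by (cases "x = crit_a") auto
      then have "81 * (9 - x\<^sup>2) * (1 + x)\<^sup>2 * crit_poly x / (81 * (1 - x) * (1 + x) ^ 3)\<^sup>2 \<le> 0"
        by (intro divide_nonpos_nonneg mult_nonneg_nonpos nonneg x') simp_all
      then show "\<exists>y. (admissible has_real_derivative y) (at x) \<and> y \<le> 0"
        using DERIV_admissible[OF x'] by blast
    qed
  next
    case False
    then have "crit_a \<le> t" by simp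
    then show ?thesis
    proof (rule DERIV_nonneg_imp_nondecreasing)
      fix x assume x: "crit_a \<le> x" "x \<le> t"
      then have x': "0 \<le> x" "x < 1" using assms crit_a_root by auto
      have "0 \<le> crit_poly x" using x x' crit_poly_strict_mono[of crit_a x] crit_a_root
        by (cases "x = crit_a") auto
      then have "0 \<le> 81 * (9 - x\<^sup>2) * (1 + x)\<^sup>2 * crit_poly x / (81 * (1 - x) * (1 + x) ^ 3)\<^sup>2"
        by (intro divide_nonneg_nonneg mult_nonneg_nonneg[OF nonneg] x') simp_all
      then show "\<exists>y. (admissible has_real_derivative y) (at x) \<and> 0 \<le> y"
        using DERIV_admissible[OF x'] by blast
    qed
  qed
qed

text \<open>With N and D the numerator and denominator of \<open>admissible\<close>,
  \<open>lambda_of\<close> is N' / D' in lowest form. At a critical point N' D = N D', so there,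
  though not identically, the two quotients agree.\<close>

lemma lambda_eq_admissible: "lambda_of crit_a = admissible crit_a"
proof -
  define t where "t = crit_a"
  have t: "1/2 < t" "t < 1" "crit_poly t = 0" using crit_a_root crit_a_bounds by (auto simp: t_def)
  have "(-81 + 1044 * t + 54 * t ^ 2 - 116 * t ^ 3 - 5 * t ^ 4) * (81 * (1 - t) * (1 + t) ^ 3)
      - (t + 29) * (9 - t\<^sup>2)\<^sup>2 * (162 * (t + 1) ^ 2 * (2 * t - 1)) 
      = - 81 * (9 - t\<^sup>2) * (t + 1) ^ 2 * crit_poly t"
    unfolding crit_poly_def by algebra
  then have eq: "(-81 + 1044 * t + 54 * t ^ 2 - 116 * t ^ 3 - 5 * t ^ 4) * (81 * (1 - t) * (1 + t) ^ 3)
      = (t + 29) * (9 - t\<^sup>2)\<^sup>2 * (162 * (t + 1) ^ 2 * (2 * t - 1))"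
    using t by simp
  have nz: "162 * (t + 1) ^ 2 * (2 * t - 1) \<noteq> 0" "81 * (1 - t) * (1 + t) ^ 3 \<noteq> 0"
    using t by auto
  show ?thesis
    unfolding lambda_of_def admissible_def t_def[symmetric]
    by (rule iffD2[OF frac_eq_eq[OF nz] eq])
qed

lemma lambda_bounds: "16.46176 < lambda_of crit_a" "lambda_of crit_a < 16.46181"
proof -
  define t where "t = crit_a"
  have t: "537869054 / 10 ^ 9 < t" "t < 537869055 / 10 ^ 9"
    using crit_a_bounds by (simp_all add: t_def)
  \<comment> \<open>As \<open>crit_a\<close> is the minimiser, any rational point gives an upper
    bound; six digits of the root suffice.\<close>
  have "admissible t \<le> admissible (537869 / 10 ^ 6)"
    unfolding t_def by (rule admissible_min) auto
  also have "\<dots> < 16.46181" by (simp add: admissible_def power_divide)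
  finally show "lambda_of crit_a < 16.46181" by (simp add: lambda_eq_admissible t_def)
  define l h :: real where "l = 537869054 / 10 ^ 9" and "h = 537869055 / 10 ^ 9"
  \<comment> \<open>Each factor is taken at the end of the bracket that makes the quotient
    smaller.\<close>
  have "16.46176 < (l + 29) * (9 - h\<^sup>2)\<^sup>2 / (81 * (1 - l) * (1 + h) ^ 3)"
    by (simp add: l_def h_def power_divide)
  also have "\<dots> \<le> admissible t"
    unfolding admissible_def
  proof (rule frac_le)
    have "t\<^sup>2 \<le> h\<^sup>2" using t by (intro power_mono) (auto simp: h_def)
    moreover have "h\<^sup>2 \<le> 9" by (simp add: h_def power_divide)
    ultimately show "(l + 29) * (9 - h\<^sup>2)\<^sup>2 \<le> (t + 29) * (9 - t\<^sup>2)\<^sup>2"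
      using t by (intro mult_mono power_mono) (auto simp: l_def)
    show "81 * (1 - t) * (1 + t) ^ 3 \<le> 81 * (1 - l) * (1 + h) ^ 3"
      using t by (intro mult_mono power_mono) (auto simp: l_def h_def)
  qed (use t in auto)
  finally show "16.46176 < lambda_of crit_a" by (simp add: lambda_eq_admissible t_def)
qed

section \<open>The bounds at radius 1/3 as functions of |f 0|\<close>

lemma defect_common_denominator:
  fixes n :: real
  assumes "n \<noteq> 0"
  shows "1 - ((n\<^sup>2 - A) / n\<^sup>2 + B / n + 16 / 9 * (9 * C / n\<^sup>2) + l * (9 * C / n\<^sup>2)\<^sup>2) =
    ((A - B * n - 16 * C) * n\<^sup>2 - 81 * l * C\<^sup>2) / n ^ 4"
  using assms by (simp add: field_simps power2_eq_square power4_eq_xxxx)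

text \<open>The sum subtracted from 1 is M at z = -1/3 for the automorphism with parameter
  \<open>a\<close>, with \<open>l\<close> in place of lambda. The other factors are nonnegative, so
  for \<open>a < 1\<close> everything rests on comparing \<open>l\<close> with
  \<open>admissible a\<close>.\<close>

lemma extremal_value_defect:
  fixes a l :: real
  assumes "0 \<le> a" "a \<le> 1"
  shows "1 - (((3 * a + 1) / (3 + a))\<^sup>2 + (1 - a\<^sup>2) / (3 - a) + 16 / 9 * (9 * (1 - a\<^sup>2)\<^sup>2 / (9 - a\<^sup>2)\<^sup>2)
      + l * (9 * (1 - a\<^sup>2)\<^sup>2 / (9 - a\<^sup>2)\<^sup>2)\<^sup>2) =
    (1 - a\<^sup>2) * (1 - a)\<^sup>2 * ((a + 29) * (9 - a\<^sup>2)\<^sup>2 - l * (81 * (1 - a) * (1 + a) ^ 3)) / (9 - a\<^sup>2) ^ 4"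
proof -
  define u n where "u = 1 - a\<^sup>2" and "n = 9 - a\<^sup>2"
  have nf: "n = (3 + a) * (3 - a)" by (simp add: n_def power2_eq_square algebra_simps)
  have pos: "3 + a \<noteq> 0" "3 - a \<noteq> 0" "n \<noteq> 0" using assms nf by auto
  have fracs: "(3 * a + 1) / (3 + a) = (3 * a + 1) * (3 - a) / n" "u / (3 - a) = u * (3 + a) / n"
    using pos by (simp_all add: nf)
  \<comment> \<open>This is (3 + a)^2 - (3 a + 1)^2 = 8 (1 - a^2), multiplied by (3 - a)^2.\<close>
  have sq: "((3 * a + 1) * (3 - a))\<^sup>2 = n\<^sup>2 - 8 * u * (3 - a)\<^sup>2"
    unfolding n_def u_def by algebra
  have num: "8 * u * (3 - a)\<^sup>2 - u * (3 + a) * n - 16 * u\<^sup>2 = u * (1 - a)\<^sup>2 * (a + 29)"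
    unfolding n_def u_def by algebra
  have u4: "(u\<^sup>2)\<^sup>2 = u * (1 - a)\<^sup>2 * ((1 - a) * (1 + a) ^ 3)"
    unfolding u_def by algebra
  have "1 - (((3 * a + 1) / (3 + a))\<^sup>2 + u / (3 - a) + 16 / 9 * (9 * u\<^sup>2 / n\<^sup>2)
      + l * (9 * u\<^sup>2 / n\<^sup>2)\<^sup>2) =
      ((8 * u * (3 - a)\<^sup>2 - u * (3 + a) * n - 16 * u\<^sup>2) * n\<^sup>2 - 81 * l * (u\<^sup>2)\<^sup>2) / n ^ 4"
    using defect_common_denominator[OF pos(3), of "8 * u * (3 - a)\<^sup>2" "u * (3 + a)" "u\<^sup>2" l]
    by (simp only: fracs sq power_divide[of "(3 * a + 1) * (3 - a)"])
  also have "\<dots> = u * (1 - a)\<^sup>2 * ((a + 29) * n\<^sup>2 - l * (81 * (1 - a) * (1 + a) ^ 3)) / n ^ 4"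
    unfolding num u4 by (simp add: algebra_simps)
  finally show ?thesis by (simp only: u_def n_def)
qed

lemma extremal_value_le_1:
  fixes a :: real
  assumes "0 \<le> a" "a \<le> 1"
  shows "((3 * a + 1) / (3 + a))\<^sup>2 + (1 - a\<^sup>2) / (3 - a) + 16 / 9 * (9 * (1 - a\<^sup>2)\<^sup>2 / (9 - a\<^sup>2)\<^sup>2)
      + lambda_of crit_a * (9 * (1 - a\<^sup>2)\<^sup>2 / (9 - a\<^sup>2)\<^sup>2)\<^sup>2 \<le> 1"
proof -
  have "lambda_of crit_a * (81 * (1 - a) * (1 + a) ^ 3) \<le> (a + 29) * (9 - a\<^sup>2)\<^sup>2"
  \<comment> \<open>At \<open>a = 1\<close> the denominator of \<open>admissible\<close> vanishes,
    but then the left side is 0.\<close>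
  proof (cases "a = 1")
    case False
    then have a: "a < 1" using assms by simp
    then have "0 < 81 * (1 - a) * (1 + a) ^ 3" using assms by simp
    then show ?thesis using admissible_min[OF assms(1) a]
      by (simp add: lambda_eq_admissible admissible_def[of a] pos_le_divide_eq)
  qed simp
  then have "0 \<le> (1 - a\<^sup>2) * (1 - a)\<^sup>2 * ((a + 29) * (9 - a\<^sup>2)\<^sup>2
      - lambda_of crit_a * (81 * (1 - a) * (1 + a) ^ 3)) / (9 - a\<^sup>2) ^ 4"
    using assms by (simp add: abs_square_le_1)
  then show ?thesis unfolding extremal_value_defect[OF assms, symmetric] by simp
qed

lemma extremal_value_crit:
  "((3 * crit_a + 1) / (3 + crit_a))\<^sup>2 + (1 - crit_a\<^sup>2) / (3 - crit_a)
      + 16 / 9 * (9 * (1 - crit_a\<^sup>2)\<^sup>2 / (9 - crit_a\<^sup>2)\<^sup>2)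
      + lambda_of crit_a * (9 * (1 - crit_a\<^sup>2)\<^sup>2 / (9 - crit_a\<^sup>2)\<^sup>2)\<^sup>2 = 1"
proof -
  have "lambda_of crit_a * (81 * (1 - crit_a) * (1 + crit_a) ^ 3) = (crit_a + 29) * (9 - crit_a\<^sup>2)\<^sup>2"
    using crit_a_root by (simp add: lambda_eq_admissible admissible_def)
  then show ?thesis using extremal_value_defect[of crit_a "lambda_of crit_a"] crit_a_root by simp
qed

text \<open>The square root is linearised at \<open>a = 1 / 3\<close>, and \<open>lambda_of crit_a\<close> is replaced by 16.462.\<close>

lemma small_value_le_1:
  fixes a :: real
  assumes "0 \<le> a" "a \<le> 1 / 3"
  shows "((3 * a + 1) / (3 + a))\<^sup>2 + sqrt ((1 - a\<^sup>2) / 8) + 16 / 9 * (9 * (1 - a\<^sup>2)\<^sup>2 / (9 - a\<^sup>2)\<^sup>2)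
      + lambda_of crit_a * (9 * (1 - a\<^sup>2)\<^sup>2 / (9 - a\<^sup>2)\<^sup>2)\<^sup>2 \<le> 1"
proof -
  have a2: "a\<^sup>2 \<le> (1 / 3)\<^sup>2" using assms by (intro power_mono)
  \<comment> \<open>With s the square root, s = 1/3 at \<open>a = 1 / 3\<close>; expanding (1 - 3
    s)^2 gives s <= (1 + 9 s^2) / 6, with equality there.\<close>
  have "0 \<le> (1 - 3 * sqrt ((1 - a\<^sup>2) / 8))\<^sup>2" by simp
  then have root: "sqrt ((1 - a\<^sup>2) / 8) \<le> 3 * (1 - a\<^sup>2) / 16 + 1 / 6"
    using a2 by (simp add: power2_diff power_mult_distrib power_divide field_simps)
  define u n where "u = 1 - a\<^sup>2" and "n = 9 - a\<^sup>2"
  have n: "n = (3 + a) * (3 - a)" by (simp add: n_def power2_eq_square algebra_simps)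
  have nz: "3 + a \<noteq> 0" "n \<noteq> 0" using assms n by auto
  have frac: "(3 * a + 1) / (3 + a) = (3 * a + 1) * (3 - a) / n"
    using nz by (simp add: n)
  have sq: "((3 * a + 1) * (3 - a))\<^sup>2 = n\<^sup>2 - 8 * u * (3 - a)\<^sup>2"
    unfolding n_def u_def by algebra
  \<comment> \<open>\<open>Q\<close> is the defect multiplied by 48 n^4, where 48 clears the
    fractions 3/16 and 1/6. The thousandths come from 48 * 81 * 16.462 = 64004.256.\<close>
  define Q where "Q = (42186744 / 1000) - 186624 * a + (191838024 / 1000) * a\<^sup>2 + 228096 * a ^ 3 - (481507536 / 1000) * a ^ 4
      - 43776 * a ^ 5 + (280203024 / 1000) * a ^ 6 + 2304 * a ^ 7 - (65497256 / 1000) * a ^ 8 + 9 * a ^ 10"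
  have "1 - (((3 * a + 1) / (3 + a))\<^sup>2 + (3 * u / 16 + 1 / 6) + 16 / 9 * (9 * u\<^sup>2 / n\<^sup>2)
      + (16462 / 1000) * (9 * u\<^sup>2 / n\<^sup>2)\<^sup>2) =
      (384 * u * (3 - a)\<^sup>2 * n\<^sup>2 - (9 * u + 8) * n ^ 4 - 768 * u\<^sup>2 * n\<^sup>2 - (64004256 / 1000) * (u\<^sup>2)\<^sup>2) / (48 * n ^ 4)"
    unfolding frac power_divide[of "(3 * a + 1) * (3 - a)"] sq
    using defect_common_denominator[OF nz(2), of "8 * u * (3 - a)\<^sup>2" "(3 * u / 16 + 1 / 6) * n" "u\<^sup>2" "(16462 / 1000)"] nz(2)
    by (simp add: field_simps power2_eq_square power4_eq_xxxx)
  also have "384 * u * (3 - a)\<^sup>2 * n\<^sup>2 - (9 * u + 8) * n ^ 4 - 768 * u\<^sup>2 * n\<^sup>2 - (64004256 / 1000) * (u\<^sup>2)\<^sup>2 = Q"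
    unfolding n_def u_def Q_def by (simp add: field_simps eval_nat_numeral)
  finally have "1 - (((3 * a + 1) / (3 + a))\<^sup>2 + (3 * u / 16 + 1 / 6) + 16 / 9 * (9 * u\<^sup>2 / n\<^sup>2)
      + (16462 / 1000) * (9 * u\<^sup>2 / n\<^sup>2)\<^sup>2) = Q / (48 * n ^ 4)" .
  moreover have "0 \<le> Q"
  proof -
    \<comment> \<open>The quadratic part of \<open>Q\<close> is expanded about 1/3, where its value
      is 1294.08; the remainder is a product of two nonnegative factors.\<close>
    have "0 \<le> (1/3 - a) * (186624 - (191838024 / 1000) * (a + 1/3))" using assms by (intro mult_nonneg_nonneg) auto
    moreover have "(42186744 / 1000) - 186624 * a + (191838024 / 1000) * a\<^sup>2 =
        (1/3 - a) * (186624 - (191838024 / 1000) * (a + 1/3)) + 129408 / 100"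
      by (simp add: power2_eq_square field_simps)
    ultimately have "0 \<le> (42186744 / 1000) - 186624 * a + (191838024 / 1000) * a\<^sup>2" by linarith
    \<comment> \<open>Since \<open>a\<close> is at most 1/3, the negative terms of higher degree are
      absorbed by positive ones of lower degree.\<close>
    moreover have "a ^ 4 \<le> 1/3 * a ^ 3" "a ^ 5 \<le> 1/3 * a ^ 4" "a ^ 6 \<le> 1/3 * a ^ 5" "a ^ 7 \<le> 1/3 * a ^ 6" "a ^ 8 \<le> 1/3 * a ^ 7"
      using assms mult_right_mono[OF assms(2), of "a ^ 3"] mult_right_mono[OF assms(2), of "a ^ 4"]
        mult_right_mono[OF assms(2), of "a ^ 5"] mult_right_mono[OF assms(2), of "a ^ 6"] mult_right_mono[OF assms(2), of "a ^ 7"]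
      by (simp_all flip: power_Suc)
    moreover have "0 \<le> a ^ 3" "0 \<le> a ^ 6" "0 \<le> a ^ 7" "0 \<le> a ^ 10" using assms by simp_all
    ultimately show ?thesis unfolding Q_def by linarith
  qed
  then have "0 \<le> Q / (48 * n ^ 4)" by simp
  moreover have "lambda_of crit_a * (9 * u\<^sup>2 / n\<^sup>2)\<^sup>2 \<le> (16462 / 1000) * (9 * u\<^sup>2 / n\<^sup>2)\<^sup>2"
    using lambda_bounds by (intro mult_right_mono) auto
  ultimately show ?thesis using root unfolding u_def[symmetric] n_def[symmetric] by linarith
qed

subsection \<open>The upper bound\<close>

locale unit_bounded =
  fixes f :: "complex \<Rightarrow> complex" and a :: real
  assumes holo: "f holomorphic_on ball 0 1"
    and bounded: "cmod z < 1 \<Longrightarrow> cmod (f z) \<le> 1"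
  defines "a \<equiv> cmod (f 0)"
begin

section \<open>First bounds, the transform of \<open>f\<close> vanishing at 0, and
  Schwarz--Pick\<close>

lemma a_nonneg: "0 \<le> a" and a_le_1: "a \<le> 1"
  using bounded[of 0] by (auto simp: a_def)

lemma taylor_coeff_0: "taylor_coeff f 0 = f 0"
  by (simp add: taylor_coeff_def fps_expansion_def)

lemma sum_taylor_coeff_le_1: "(\<Sum>k<n. (cmod (taylor_coeff f k))\<^sup>2) \<le> 1"
  using sum_taylor_coeff_dominated[OF holo, where n = 1 and p = "\<lambda>_. 1" and m = n] bounded by simp

lemma sum_taylor_coeff_Suc_le: "(\<Sum>k<n. (cmod (taylor_coeff f (Suc k)))\<^sup>2) \<le> 1 - a\<^sup>2"
  using sum_taylor_coeff_le_1[of "Suc n"]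
  by (simp add: sum.lessThan_Suc_shift taylor_coeff_0 a_def del: sum.lessThan_Suc)

text \<open>The g of the introduction: \<open>f\<close> followed by the disk automorphism that sends
  \<open>f 0\<close> to 0. For \<open>a = 1\<close> the denominator already vanishes at 0, which is
  why \<open>a < 1\<close> is assumed below.\<close>

definition moebius :: "complex \<Rightarrow> complex" where
  "moebius z = (f z - f 0) / (1 - cnj (f 0) * f z)"

lemma moebius_denom_nz:
  assumes "a < 1" "cmod z < 1"
  shows "1 - cnj (f 0) * f z \<noteq> 0"
proof
  assume "1 - cnj (f 0) * f z = 0"
  then have "cmod (cnj (f 0) * f z) = 1" by (metis norm_one eq_iff_diff_eq_0)
  moreover have "a * cmod (f z) \<le> a * 1"
    using bounded[OF assms(2)] a_nonneg by (intro mult_left_mono) auto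
  ultimately show False using assms(1) by (simp add: norm_mult a_def)
qed

lemma moebius_holomorphic:
  assumes "a < 1"
  shows "moebius holomorphic_on ball 0 1"
  unfolding moebius_def using moebius_denom_nz[OF assms] by (auto intro!: holomorphic_intros holo)

text \<open>Follows from the identity |1 - cnj c w|^2 - |w - c|^2 = (1 - |c|^2) (1 - |w|^2) with c =
  \<open>f 0\<close> and w = \<open>f z\<close>.\<close>

lemma norm_moebius_le_1:
  assumes "a < 1" "cmod z < 1"
  shows "cmod (moebius z) \<le> 1"
proof -
  have eq: "(cmod (1 - cnj (f 0) * f z))\<^sup>2 - (cmod (f z - f 0))\<^sup>2 = (1 - a\<^sup>2) * (1 - (cmod (f z))\<^sup>2)"
    unfolding a_def cmod_power2 by (simp add: power2_eq_square algebra_simps)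
  have "0 \<le> (1 - a\<^sup>2) * (1 - (cmod (f z))\<^sup>2)"
    using bounded[OF assms(2)] a_nonneg a_le_1
    by (intro mult_nonneg_nonneg) (auto simp: abs_square_le_1)
  then have "(cmod (f z - f 0))\<^sup>2 \<le> (cmod (1 - cnj (f 0) * f z))\<^sup>2" using eq by linarith
  then have "cmod (f z - f 0) \<le> cmod (1 - cnj (f 0) * f z)"
    by (rule power2_le_imp_le) simp
  then show ?thesis using moebius_denom_nz[OF assms]
    by (simp add: moebius_def norm_divide divide_le_eq_1)
qed

text \<open>The Schwarz lemma for \<open>moebius\<close>, reduced to moduli. Solved for |f z| it is
  the familiar bound (a + |z|) / (1 + a |z|).\<close>

lemma schwarz_pick:
  assumes z: "cmod z < 1"
  shows "cmod (f z) - a \<le> cmod z * (1 - a * cmod (f z))"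
proof (cases "a = 1")
  case True
  then show ?thesis using bounded[OF z] z
    by (simp add: mult_nonneg_nonneg order_trans[OF _ mult_nonneg_nonneg])
next
  case False
  then have a1: "a < 1" using a_le_1 by simp
  \<comment> \<open>The Schwarz lemma is applied with a strict bound, whereas
    \<open>norm_moebius_le_1\<close> is weak; hence the scaling by \<open>c\<close>, which is then
    removed by letting it approach 1.\<close>
  have "cmod (of_real c * moebius z) \<le> cmod z" if c: "0 < c" "c < 1" for c :: real
  proof (rule Schwarz_Lemma(1)[where f = "\<lambda>z. of_real c * moebius z"])
    fix w :: complex assume "cmod w < 1"
    then have "c * cmod (moebius w) \<le> c * 1"
      using norm_moebius_le_1[OF a1] c by (intro mult_left_mono) auto
    moreover have "cmod (of_real c * moebius w) = c * cmod (moebius w)"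
      using c by (simp add: norm_mult)
    ultimately show "cmod (of_real c * moebius w) < 1" using c by linarith
  next
    show "(\<lambda>z. of_real c * moebius z) holomorphic_on ball 0 1"
      by (intro holomorphic_intros moebius_holomorphic[OF a1])
  qed (use z in \<open>simp_all add: moebius_def\<close>)
  then have "c * cmod (moebius z) \<le> cmod z" if "0 < c" "c < 1" for c
    using that by (simp add: norm_mult)
  then have le: "cmod (moebius z) \<le> cmod z"
    by (rule field_le_mult_one_interval)
  have nz: "1 - cnj (f 0) * f z \<noteq> 0" by (rule moebius_denom_nz[OF a1 z])
  then have le': "cmod (f z - f 0) \<le> cmod z * cmod (1 - cnj (f 0) * f z)"
    using le by (simp add: moebius_def norm_divide pos_divide_le_eq)
  \<comment> \<open>From here only moduli count: the same identity eliminates |f z - f 0|, and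
    \<open>N\<close> is at least (1 - a x)^2 by the triangle inequality.\<close>
  define x r N where "x = cmod (f z)" and "r = cmod z" and "N = (cmod (1 - cnj (f 0) * f z))\<^sup>2"
  have eq: "N - (cmod (f z - f 0))\<^sup>2 = (1 - a\<^sup>2) * (1 - x\<^sup>2)"
    unfolding a_def x_def N_def cmod_power2 by (simp add: power2_eq_square algebra_simps)
  have ax: "a * x \<le> 1" using bounded[OF z] a_nonneg a_le_1
    by (auto simp: x_def intro: mult_le_one)
  have "(cmod (f z - f 0))\<^sup>2 \<le> r\<^sup>2 * N"
    using power_mono[OF le', of 2] by (simp add: N_def r_def power_mult_distrib)
  then have "(1 - r\<^sup>2) * N \<le> (1 - a\<^sup>2) * (1 - x\<^sup>2)" using eq by (simp add: algebra_simps)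
  moreover have "(1 - r\<^sup>2) * (1 - a * x)\<^sup>2 \<le> (1 - r\<^sup>2) * N"
  proof (rule mult_left_mono)
    have "1 - a * x \<le> cmod (1 - cnj (f 0) * f z)"
      using norm_triangle_ineq2[of 1 "cnj (f 0) * f z"] by (simp add: norm_mult a_def x_def)
    then show "(1 - a * x)\<^sup>2 \<le> N" unfolding N_def using ax by (intro power_mono) auto
    show "0 \<le> 1 - r\<^sup>2" using z by (simp add: r_def power_le_one)
  qed
  moreover have "(x - a)\<^sup>2 = (1 - a * x)\<^sup>2 - (1 - a\<^sup>2) * (1 - x\<^sup>2)"
    by (simp add: power2_eq_square algebra_simps)
  ultimately have "(x - a)\<^sup>2 \<le> (1 - a * x)\<^sup>2 - (1 - r\<^sup>2) * (1 - a * x)\<^sup>2" by linarith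
  then have "(x - a)\<^sup>2 \<le> (r * (1 - a * x))\<^sup>2"
    unfolding power_mult_distrib left_diff_distrib by simp
  then have "x - a \<le> r * (1 - a * x)"
    by (rule power2_le_imp_le) (use ax in \<open>simp add: r_def\<close>)
  then show ?thesis by (simp add: x_def r_def)
qed

text \<open>As \<open>moebius\<close> vanishes at 0, truncating its cofactor 1 - cnj (f 0) f at
  degree \<open>n\<close> does not change the product's coefficients up to degree n + 1. The
  truncated product is dominated by the polynomial with coefficients \<open>p 0 = 1 - a^2\<close>
  and \<open>p (Suc k)\<close> of modulus a |a_(k+1)|.\<close>

lemma sum_taylor_coeff_step:
  assumes a1: "a < 1"
  shows "(\<Sum>k<Suc n. (cmod (taylor_coeff f (Suc k)))\<^sup>2) \<le>
    (1 - a\<^sup>2)\<^sup>2 + a\<^sup>2 * (\<Sum>k<n. (cmod (taylor_coeff f (Suc k)))\<^sup>2)"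
proof -
  define F G where "F = fps_expansion f 0" and "G = fps_expansion moebius 0"
  have F: "f has_fps_expansion F" unfolding F_def by (rule has_fps_expansion_taylor[OF holo])
  have G: "moebius has_fps_expansion G"
    unfolding G_def by (rule has_fps_expansion_taylor[OF moebius_holomorphic[OF a1]])
  have F0: "fps_nth F 0 = f 0" by (simp add: F_def fps_expansion_def)
  have G0: "fps_nth G 0 = 0" by (simp add: G_def fps_expansion_def moebius_def)
  have "(\<lambda>z. moebius z * (1 - cnj (f 0) * f z)) has_fps_expansion
      G * (1 - fps_const (cnj (f 0)) * F)"
    by (intro fps_expansion_intros F G)
  moreover have "(\<lambda>z. f z - f 0) has_fps_expansion F - fps_const (f 0)"
    by (intro fps_expansion_intros F)
  moreover have "eventually (\<lambda>z. moebius z * (1 - cnj (f 0) * f z) = f z - f 0) (nhds 0)"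
  proof (rule eventually_nhds_in_open[THEN eventually_mono, of "ball 0 1"])
    fix z :: complex assume "z \<in> ball 0 1"
    then show "moebius z * (1 - cnj (f 0) * f z) = f z - f 0"
      using moebius_denom_nz[OF a1, of z] by (simp add: moebius_def)
  qed auto
  ultimately have FG: "G * (1 - fps_const (cnj (f 0)) * F) = F - fps_const (f 0)"
    using fps_expansion_unique_complex has_fps_expansion_cong by metis
  define p where "p k = fps_nth (1 - fps_const (cnj (f 0)) * F) k" for k
  define P where "P = (\<Sum>k<Suc n. fps_const (p k) * fps_X ^ k)"
  define h where "h z = moebius z * (\<Sum>k<Suc n. p k * z ^ k)" for z
  have P_nth: "fps_nth P k = (if k < Suc n then p k else 0)" for k
    by (simp add: P_def fps_sum_nth if_distrib cong: if_cong del: sum.lessThan_Suc)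
  have "h has_fps_expansion G * P"
    unfolding h_def P_def by (intro fps_expansion_intros G)
  then have h_nth: "taylor_coeff h k = fps_nth (G * P) k" for k by (rule taylor_coeff_eqI)
  have coeff: "taylor_coeff h (Suc k) = taylor_coeff f (Suc k)" if "k < Suc n" for k
  proof -
    have "fps_nth (G * P) (Suc k) = fps_nth (G * (1 - fps_const (cnj (f 0)) * F)) (Suc k)"
      unfolding fps_mult_nth
    proof (rule sum.cong)
      fix i assume "i \<in> {0..Suc k}"
      then show "fps_nth G i * fps_nth P (Suc k - i) =
          fps_nth G i * fps_nth (1 - fps_const (cnj (f 0)) * F) (Suc k - i)"
        \<comment> \<open>Only \<open>i = 0\<close> would reach beyond the truncation, and there the
          factor from \<open>G\<close> is 0.\<close>
        using G0 that by (cases "i = 0") (auto simp: P_nth p_def simp del: fps_sub_nth)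
    qed simp
    then show ?thesis using FG h_nth[of "Suc k"] by (simp add: taylor_coeff_def F_def)
  qed
  have "(\<Sum>k<Suc n. (cmod (taylor_coeff f (Suc k)))\<^sup>2) = (\<Sum>k<Suc n. (cmod (taylor_coeff h (Suc k)))\<^sup>2)"
    by (rule sum.cong) (auto simp: coeff)
  also have "\<dots> \<le> (\<Sum>k<Suc (Suc n). (cmod (taylor_coeff h k))\<^sup>2)"
    by (subst (2) sum.lessThan_Suc_shift) simp
  also have "\<dots> \<le> (\<Sum>k<Suc n. (cmod (p k))\<^sup>2)"
  proof (rule sum_taylor_coeff_dominated)
    show "h holomorphic_on ball 0 1" unfolding h_def
      by (intro holomorphic_intros moebius_holomorphic[OF a1])
    show "cmod (h z) \<le> cmod (\<Sum>k<Suc n. p k * z ^ k)" if "cmod z < 1" for z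
      unfolding h_def norm_mult using norm_moebius_le_1[OF a1 that] by (intro mult_left_le_one_le) auto
  qed
  also have "\<dots> = (cmod (p 0))\<^sup>2 + (\<Sum>k<n. (cmod (p (Suc k)))\<^sup>2)"
    by (rule sum.lessThan_Suc_shift)
  also have "p 0 = of_real (1 - a\<^sup>2)"
    by (simp add: p_def F0 a_def complex_norm_square mult.commute del: of_real_power)
  also have "cmod (of_real (1 - a\<^sup>2)) = 1 - a\<^sup>2"
    using a_nonneg a_le_1 by (subst norm_of_real) (simp add: abs_square_le_1)
  also have "(\<Sum>k<n. (cmod (p (Suc k)))\<^sup>2) = a\<^sup>2 * (\<Sum>k<n. (cmod (taylor_coeff f (Suc k)))\<^sup>2)"
    by (simp add: p_def taylor_coeff_def F_def[symmetric] norm_mult a_def power_mult_distrib sum_distrib_left)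
  finally show ?thesis .
qed

text \<open>The right-hand side is attained by the disk automorphism (a - z) / (1 - a z).\<close>

lemma sum_taylor_coeff_le:
  "(\<Sum>k<n. (cmod (taylor_coeff f (Suc k)))\<^sup>2) \<le> (\<Sum>k<n. (1 - a\<^sup>2)\<^sup>2 * (a\<^sup>2) ^ k)"
proof (cases "a = 1")
  case True
  then show ?thesis using sum_taylor_coeff_Suc_le[of n] by simp
next
  case False
  then have a1: "a < 1" using a_le_1 by simp
  show ?thesis
  proof (induction n)
    case (Suc n)
    have "(\<Sum>k<Suc n. (cmod (taylor_coeff f (Suc k)))\<^sup>2) \<le>
        (1 - a\<^sup>2)\<^sup>2 + a\<^sup>2 * (\<Sum>k<n. (cmod (taylor_coeff f (Suc k)))\<^sup>2)"
      by (rule sum_taylor_coeff_step[OF a1])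
    also have "\<dots> \<le> (1 - a\<^sup>2)\<^sup>2 + a\<^sup>2 * (\<Sum>k<n. (1 - a\<^sup>2)\<^sup>2 * (a\<^sup>2) ^ k)"
      using Suc.IH by (intro add_left_mono mult_left_mono) auto
    also have "\<dots> = (\<Sum>k<Suc n. (1 - a\<^sup>2)\<^sup>2 * (a\<^sup>2) ^ k)"
      by (subst sum.lessThan_Suc_shift) (simp add: sum_distrib_left mult_ac)
    finally show ?case .
  qed simp
qed

text \<open>The common route to the area and the majorant series: comparison with the automorphism
  under decreasing weights.\<close>

lemma sum_taylor_coeff_weighted_le:
  assumes "decseq c" "\<And>k. 0 \<le> c k" "(\<lambda>k. c k * (a\<^sup>2) ^ k) sums C"
  shows "(\<Sum>k<n. c k * (cmod (taylor_coeff f (Suc k)))\<^sup>2) \<le> (1 - a\<^sup>2)\<^sup>2 * C"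
proof -
  have "(\<Sum>k<n. c k * (cmod (taylor_coeff f (Suc k)))\<^sup>2) \<le> (\<Sum>k<n. c k * ((1 - a\<^sup>2)\<^sup>2 * (a\<^sup>2) ^ k))"
    by (intro weighted_sum_mono sum_taylor_coeff_le assms)
  also have "\<dots> = (1 - a\<^sup>2)\<^sup>2 * (\<Sum>k<n. c k * (a\<^sup>2) ^ k)"
    by (simp add: sum_distrib_left mult_ac)
  also have "\<dots> \<le> (1 - a\<^sup>2)\<^sup>2 * C"
    using sum_le_suminf[of "\<lambda>k. c k * (a\<^sup>2) ^ k" "{..<n}"] assms
    by (intro mult_left_mono) (auto simp: sums_iff)
  finally show ?thesis .
qed

text \<open>The weights (k + 1) r^(2 k + 2) decrease because (k + 2) r^2 <= k + 1; the case k = 0 is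
  what demands \<open>r^2 <= 1 / 2\<close>. The closed form is the differentiated geometric series
  in a^2 r^2.\<close>

lemma image_area_bounds:
  assumes r: "0 \<le> r" "r\<^sup>2 \<le> 1 / 2"
  shows "0 \<le> image_area f r / pi"
    and "image_area f r / pi \<le> (1 - a\<^sup>2)\<^sup>2 * (r\<^sup>2 / (1 - a\<^sup>2 * r\<^sup>2)\<^sup>2)"
proof -
  define c where "c k = real (Suc k) * r ^ (2 * Suc k)" for k
  have c0: "0 \<le> c k" for k using r by (simp add: c_def)
  have dec: "decseq c"
  proof (rule decseq_SucI)
    fix k
    have "real (Suc (Suc k)) * r\<^sup>2 \<le> real (Suc (Suc k)) * (1 / 2)"
      using r by (intro mult_left_mono) auto
    also have "\<dots> \<le> real (Suc k)" by simp
    finally have "real (Suc (Suc k)) * r\<^sup>2 \<le> real (Suc k)" .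
    then have "real (Suc (Suc k)) * r\<^sup>2 * r ^ (2 * Suc k) \<le> real (Suc k) * r ^ (2 * Suc k)"
      using r by (intro mult_right_mono) auto
    then show "c (Suc k) \<le> c k" by (simp add: c_def power2_eq_square mult_ac)
  qed
  have "a\<^sup>2 * r\<^sup>2 \<le> 1 * (1 / 2)"
    using r a_nonneg a_le_1 by (intro mult_mono) (auto simp: abs_square_le_1)
  then have "(\<lambda>k. r\<^sup>2 * (of_nat (Suc k) * (a\<^sup>2 * r\<^sup>2) ^ k)) sums (r\<^sup>2 * (1 / (1 - a\<^sup>2 * r\<^sup>2)\<^sup>2))"
    by (intro sums_mult geometric_deriv_sums) (simp add: abs_mult)
  moreover have "r\<^sup>2 * (of_nat (Suc k) * (a\<^sup>2 * r\<^sup>2) ^ k) = c k * (a\<^sup>2) ^ k" for k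
    unfolding c_def power_mult power_mult_distrib power_Suc by (simp only: mult_ac)
  ultimately have C: "(\<lambda>k. c k * (a\<^sup>2) ^ k) sums (r\<^sup>2 / (1 - a\<^sup>2 * r\<^sup>2)\<^sup>2)" by simp
  define s where "s k = c k * (cmod (taylor_coeff f (Suc k)))\<^sup>2" for k
  have s0: "0 \<le> s k" for k using c0 by (simp add: s_def)
  have bd: "(\<Sum>k<n. s k) \<le> (1 - a\<^sup>2)\<^sup>2 * (r\<^sup>2 / (1 - a\<^sup>2 * r\<^sup>2)\<^sup>2)" for n
    unfolding s_def by (rule sum_taylor_coeff_weighted_le[OF dec c0 C])
  \<comment> \<open>The same bound on partial sums supplies convergence, so that
    \<open>suminf\<close> is a genuine sum.\<close>
  have summ: "summable s" by (rule summableI_nonneg_bounded[OF s0 bd])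
  have "image_area f r / pi = suminf s"
    by (simp add: image_area_def s_def[abs_def] c_def mult_ac)
  then show "0 \<le> image_area f r / pi"
    "image_area f r / pi \<le> (1 - a\<^sup>2)\<^sup>2 * (r\<^sup>2 / (1 - a\<^sup>2 * r\<^sup>2)\<^sup>2)"
    using suminf_nonneg[OF summ s0] suminf_le_const[OF summ bd] by simp_all
qed

text \<open>Cauchy--Schwarz, with weights \<open>(r / d) ^ k\<close> and \<open>(r * d) ^ k\<close> for the two factors.\<close>

lemma majorant_le:
  assumes r: "0 \<le> r" and d: "0 < d" "r * d < 1" and B: "0 \<le> B"
    and le: "\<And>n. (\<Sum>k<n. (r / d) ^ k * (cmod (taylor_coeff f (Suc k)))\<^sup>2) \<le> B\<^sup>2 * (1 - r * d)"
  shows "(\<Sum>k. cmod (taylor_coeff f (Suc k)) * r ^ Suc k) \<le> r * B"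
proof -
  \<comment> \<open>One factor \<open>r\<close> is split off: the terms carry \<open>r ^ k\<close>
    rather than \<open>r ^ Suc k\<close>.\<close>
  define s where "s k = cmod (taylor_coeff f (Suc k)) * r ^ k" for k
  have s0: "0 \<le> s k" for k using r by (simp add: s_def)
  have bd: "(\<Sum>k<n. s k) \<le> B" for n
  proof -
    define x y where "x k = sqrt ((r / d) ^ k) * cmod (taylor_coeff f (Suc k))"
      and "y k = sqrt ((r * d) ^ k)" for k
    have xy: "s k = x k * y k" for k
    proof -
      have "sqrt ((r / d) ^ k) * sqrt ((r * d) ^ k) = sqrt ((r ^ k)\<^sup>2)"
        using d by (simp add: power_divide power_mult_distrib power2_eq_square flip: real_sqrt_mult)
      then show ?thesis using r by (simp add: s_def x_def y_def mult_ac)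
    qed
    have "(\<Sum>k<n. s k)\<^sup>2 \<le> (\<Sum>k<n. (x k)\<^sup>2) * (\<Sum>k<n. (y k)\<^sup>2)"
      unfolding xy by (rule Cauchy_Schwarz_ineq_sum)
    also have "\<dots> \<le> (B\<^sup>2 * (1 - r * d)) * (1 / (1 - r * d))"
    proof (rule mult_mono)
      show "(\<Sum>k<n. (x k)\<^sup>2) \<le> B\<^sup>2 * (1 - r * d)"
        using le[of n] r d by (simp add: x_def power_mult_distrib)
      have "(\<Sum>k<n. (y k)\<^sup>2) = (\<Sum>k<n. (r * d) ^ k)"
        using r d by (simp add: y_def)
      also have "\<dots> \<le> 1 / (1 - r * d)"
        using sum_le_suminf[of "\<lambda>k. (r * d) ^ k" "{..<n}"] r d geometric_sums[of "r * d"]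
        by (auto simp: sums_iff)
      finally show "(\<Sum>k<n. (y k)\<^sup>2) \<le> 1 / (1 - r * d)" .
    qed (use d in \<open>auto intro: sum_nonneg\<close>)
    also have "\<dots> = B\<^sup>2" using d by simp
    finally show ?thesis using B by (rule power2_le_imp_le)
  qed
  have summ: "summable s" by (rule summableI_nonneg_bounded[OF s0 bd])
  have "(\<Sum>k. cmod (taylor_coeff f (Suc k)) * r ^ Suc k) = (\<Sum>k. r * s k)"
    by (simp add: s_def mult_ac)
  also have "\<dots> = r * suminf s" by (rule suminf_mult[OF summ])
  also have "\<dots> \<le> r * B"
    using suminf_le_const[OF summ bd] r by (rule mult_left_mono)
  finally show ?thesis .
qed

text \<open>The choice \<open>d = a\<close> makes Cauchy--Schwarz sharp: for the automorphism both
  weighted sequences are proportional to (r a)^k. The weights (r / a)^k decrease precisely because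
  \<open>r\<close> is at most \<open>a\<close>.\<close>

lemma majorant_le_large:
  assumes r: "0 \<le> r" "r \<le> a" "r < 1"
  shows "(\<Sum>k. cmod (taylor_coeff f (Suc k)) * r ^ Suc k) \<le> r * ((1 - a\<^sup>2) / (1 - r * a))"
proof (cases "a = 0")
  case True
  then show ?thesis using r by simp
next
  case False
  then have a: "0 < a" using a_nonneg by simp
  have "r * a \<le> r * 1" using r a_le_1 by (intro mult_left_mono) auto
  then have ra: "r * a < 1" using r by simp
  have q: "0 \<le> r / a" "r / a \<le> 1" using a r by auto
  have "(\<lambda>k. (r * a) ^ k) sums (1 / (1 - r * a))"
    using ra r a by (intro geometric_sums) (simp add: abs_mult)
  moreover have "(r / a) ^ k * (a\<^sup>2) ^ k = (r * a) ^ k" for k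
    using a by (simp add: power2_eq_square flip: power_mult_distrib)
  ultimately have C: "(\<lambda>k. (r / a) ^ k * (a\<^sup>2) ^ k) sums (1 / (1 - r * a))" by simp
  show ?thesis
  proof (rule majorant_le[OF r(1) a ra])
    show "0 \<le> (1 - a\<^sup>2) / (1 - r * a)" using ra a_nonneg a_le_1 by (simp add: abs_square_le_1)
    fix n
    have "(\<Sum>k<n. (r / a) ^ k * (cmod (taylor_coeff f (Suc k)))\<^sup>2) \<le> (1 - a\<^sup>2)\<^sup>2 * (1 / (1 - r * a))"
      by (rule sum_taylor_coeff_weighted_le[OF _ _ C])
        (use q in \<open>simp_all add: decseq_def power_decreasing\<close>)
    also have "\<dots> = ((1 - a\<^sup>2) / (1 - r * a))\<^sup>2 * (1 - r * a)"
      using ra by (simp add: power2_eq_square)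
    finally show "(\<Sum>k<n. (r / a) ^ k * (cmod (taylor_coeff f (Suc k)))\<^sup>2) \<le> \<dots>" .
  qed
qed

text \<open>The choice \<open>d = r\<close> makes all weights 1, so the bound 1 - a^2 on the sum of
  squares suffices, without comparing \<open>r\<close> and \<open>a\<close>.\<close>

lemma majorant_le_small:
  assumes r: "0 \<le> r" "r < 1"
  shows "(\<Sum>k. cmod (taylor_coeff f (Suc k)) * r ^ Suc k) \<le> r * sqrt ((1 - a\<^sup>2) / (1 - r\<^sup>2))"
proof (cases "r = 0")
  case False
  then have r0: "0 < r" using r by simp
  have rr: "r * r < 1" using r by (metis abs_of_nonneg abs_square_less_1 power2_eq_square)
  have u: "0 \<le> 1 - a\<^sup>2" using a_nonneg a_le_1 by (simp add: abs_square_le_1)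
  show ?thesis
  proof (rule majorant_le[OF r(1) r0 rr])
    show "0 \<le> sqrt ((1 - a\<^sup>2) / (1 - r\<^sup>2))" using u rr by (simp add: power2_eq_square)
    show "(\<Sum>k<n. (r / r) ^ k * (cmod (taylor_coeff f (Suc k)))\<^sup>2)
        \<le> (sqrt ((1 - a\<^sup>2) / (1 - r\<^sup>2)))\<^sup>2 * (1 - r * r)" for n
      using sum_taylor_coeff_Suc_le[of n] r0 u rr by (simp add: power2_eq_square[of r])
  qed
qed simp

lemma image_area_le_third:
  assumes r: "0 \<le> r" "r \<le> 1 / 3"
  shows "image_area f r / pi \<le> 9 * (1 - a\<^sup>2)\<^sup>2 / (9 - a\<^sup>2)\<^sup>2"
proof -
  have r2: "r\<^sup>2 \<le> 1 / 9" using power_mono[OF r(2,1), of 2] by (simp add: power_divide)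
  have a2: "a\<^sup>2 \<le> 1" using a_nonneg a_le_1 by (simp add: abs_square_le_1)
  have "image_area f r / pi \<le> (1 - a\<^sup>2)\<^sup>2 * (r\<^sup>2 / (1 - a\<^sup>2 * r\<^sup>2)\<^sup>2)"
    by (rule image_area_bounds) (use r r2 in auto)
  also have "\<dots> \<le> (1 - a\<^sup>2)\<^sup>2 * ((1 / 9) / (1 - a\<^sup>2 * (1 / 9))\<^sup>2)"
  proof (intro mult_left_mono frac_le power_mono)
    show "1 - a\<^sup>2 * (1 / 9) \<le> 1 - a\<^sup>2 * r\<^sup>2" using mult_left_mono[OF r2, of "a\<^sup>2"] by simp
  qed (use a2 r2 in auto)
  also have "\<dots> = 9 * (1 - a\<^sup>2)\<^sup>2 / (9 - a\<^sup>2)\<^sup>2"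
  proof -
    have "1 - a\<^sup>2 * (1 / 9) = (9 - a\<^sup>2) / 9" by simp
    then show ?thesis using a2 by (simp only: power_divide) simp
  qed
  finally show ?thesis .
qed

text \<open>Each summand is replaced by a bound at radius 1/3. For \<open>1 / 3 <= a < 1\<close>
  nothing is lost, as one automorphism attains all these bounds at the same point.\<close>

lemma bohr_M_le_1:
  assumes z: "cmod z = r" and r: "r \<le> 1 / 3"
  shows "bohr_M f z r \<le> 1"
proof -
  have r0: "0 \<le> r" using z by auto
  define x B S where "x = cmod (f z)"
    and "B = (\<Sum>k. cmod (taylor_coeff f (Suc k)) * r ^ Suc k)" and "S = image_area f r / pi"
  define T where "T = 9 * (1 - a\<^sup>2)\<^sup>2 / (9 - a\<^sup>2)\<^sup>2"
  have a2: "a\<^sup>2 \<le> 1" using a_nonneg a_le_1 by (simp add: abs_square_le_1)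
  have x1: "x \<le> 1" using bounded z r by (simp add: x_def)
  have "x \<le> (3 * a + 1) / (3 + a)"
  proof -
    have "a * x \<le> 1" using x1 a_nonneg a_le_1 by (auto simp: x_def intro: mult_le_one)
    then have "r * (1 - a * x) \<le> 1 / 3 * (1 - a * x)" using r by (intro mult_right_mono) auto
    moreover have "x - a \<le> r * (1 - a * x)" using schwarz_pick[of z] z r by (simp add: x_def)
    ultimately have "x * (3 + a) \<le> 3 * a + 1" by (simp add: algebra_simps)
    then show ?thesis using a_nonneg by (simp add: pos_le_divide_eq)
  qed
  then have x: "x\<^sup>2 \<le> ((3 * a + 1) / (3 + a))\<^sup>2" by (rule power_mono) (simp add: x_def)
  have "r\<^sup>2 \<le> (1 / 3)\<^sup>2" using r r0 by (intro power_mono)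
  then have r2: "r\<^sup>2 \<le> 1 / 9" by (simp add: power_divide)
  have S: "0 \<le> S" "S \<le> T"
    using image_area_bounds(1)[of r] image_area_le_third[of r] r r0 r2 by (simp_all add: S_def T_def)
  have "S\<^sup>2 \<le> T\<^sup>2" using S by (intro power_mono)
  then have "lambda_of crit_a * S\<^sup>2 \<le> lambda_of crit_a * T\<^sup>2"
    using lambda_bounds by (intro mult_left_mono) auto
  moreover have "((3 * a + 1) / (3 + a))\<^sup>2 + B + 16 / 9 * T + lambda_of crit_a * T\<^sup>2 \<le> 1"
  \<comment> \<open>From 1/3 on, \<open>r <= a\<close> holds for every radius considered and the
    sharp majorant bound applies; below, the cruder one must do.\<close>
  proof (cases "1 / 3 \<le> a")
    case True
    then have "r \<le> a" using r by simp
    then have "B \<le> r * ((1 - a\<^sup>2) / (1 - r * a))"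
      unfolding B_def using r r0 by (intro majorant_le_large) auto
    also have "\<dots> \<le> 1 / 3 * ((1 - a\<^sup>2) / (1 - 1 / 3 * a))"
    proof (intro mult_mono frac_le)
      show "1 - 1 / 3 * a \<le> 1 - r * a" using mult_right_mono[OF r a_nonneg] by simp
      then show "0 \<le> (1 - a\<^sup>2) / (1 - r * a)" using a2 a_le_1 by simp
    qed (use r r0 a2 a_le_1 in auto)
    also have "\<dots> = (1 - a\<^sup>2) / (3 - a)" using a_le_1 by (simp add: field_simps)
    finally show ?thesis using extremal_value_le_1[OF a_nonneg a_le_1] by (simp add: T_def)
  next
    case False
    have "B \<le> r * sqrt ((1 - a\<^sup>2) / (1 - r\<^sup>2))"
      unfolding B_def using r r0 by (intro majorant_le_small) auto
    also have "\<dots> \<le> 1 / 3 * sqrt ((1 - a\<^sup>2) / (8 / 9))"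
      by (intro mult_mono real_sqrt_le_mono frac_le) (use r r0 r2 a2 in auto)
    also have "\<dots> = sqrt ((1 / 3)\<^sup>2 * ((1 - a\<^sup>2) / (8 / 9)))"
      by (simp only: real_sqrt_mult real_sqrt_abs)
    also have "\<dots> = sqrt ((1 - a\<^sup>2) / 8)" by (simp add: power2_eq_square)
    finally show ?thesis using small_value_le_1[OF a_nonneg] False by (simp add: T_def)
  qed
  ultimately show ?thesis using x S(2)
    unfolding bohr_M_def x_def[symmetric] B_def[symmetric] S_def[symmetric] by linarith
qed

end

subsection \<open>Sharpness\<close>

lemma extremal_denom_nz:
  assumes "0 \<le> a" "a < 1" "cmod z < 1"
  shows "1 - of_real a * z \<noteq> 0"
proof
  assume "1 - of_real a * z = 0"
  then have "cmod (of_real a * z) = 1" by (metis norm_one eq_iff_diff_eq_0)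
  then have "a * cmod z = 1" using assms by (simp add: norm_mult)
  moreover have "a * cmod z \<le> a * 1" using assms by (intro mult_left_mono) auto
  ultimately show False using assms by simp
qed

lemma extremal_holomorphic:
  assumes "0 \<le> a" "a < 1"
  shows "extremal_f a holomorphic_on ball 0 1"
  unfolding extremal_f_def[abs_def] using extremal_denom_nz[OF assms] by (auto intro!: holomorphic_intros)

lemma norm_extremal_le_1:
  assumes "0 \<le> a" "a < 1" "cmod z < 1"
  shows "cmod (extremal_f a z) \<le> 1"
proof -
  have "(cmod (1 - of_real a * z))\<^sup>2 - (cmod (of_real a - z))\<^sup>2 = (1 - a\<^sup>2) * (1 - (cmod z)\<^sup>2)"
    unfolding cmod_power2 by (simp add: power2_eq_square algebra_simps)
  moreover have "0 \<le> (1 - a\<^sup>2) * (1 - (cmod z)\<^sup>2)"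
    using assms by (intro mult_nonneg_nonneg) (auto simp: abs_square_le_1)
  ultimately have "(cmod (of_real a - z))\<^sup>2 \<le> (cmod (1 - of_real a * z))\<^sup>2" by linarith
  then have "cmod (of_real a - z) \<le> cmod (1 - of_real a * z)"
    by (rule power2_le_imp_le) simp
  then show ?thesis using extremal_denom_nz[OF assms]
    by (simp add: extremal_f_def norm_divide divide_le_eq_1)
qed

text \<open>Comparing coefficients in f(z) (1 - a z) = a - z gives a geometric recursion; the term
  -z enters only at degree 1.\<close>

lemma taylor_coeff_extremal:
  assumes "0 \<le> a" "a < 1"
  shows "taylor_coeff (extremal_f a) (Suc k) = - of_real ((1 - a\<^sup>2) * a ^ k)"
proof -
  define F where "F = fps_expansion (extremal_f a) 0"
  have F: "extremal_f a has_fps_expansion F"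
    unfolding F_def by (rule has_fps_expansion_taylor[OF extremal_holomorphic[OF assms]])
  have "(\<lambda>z. extremal_f a z * (1 - of_real a * z)) has_fps_expansion F * (1 - fps_const (of_real a) * fps_X)"
    by (intro fps_expansion_intros F)
  moreover have "(\<lambda>z. of_real a - z) has_fps_expansion fps_const (of_real a) - fps_X"
    by (intro fps_expansion_intros)
  moreover have "eventually (\<lambda>z. extremal_f a z * (1 - of_real a * z) = of_real a - z) (nhds 0)"
  proof (rule eventually_nhds_in_open[THEN eventually_mono, of "ball 0 1"])
    fix z :: complex assume "z \<in> ball 0 1"
    then show "extremal_f a z * (1 - of_real a * z) = of_real a - z"
      using extremal_denom_nz[OF assms, of z] by (simp add: extremal_f_def)
  qed auto
  ultimately have eq: "F * (1 - fps_const (of_real a) * fps_X) = fps_const (of_real a) - fps_X"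
    using fps_expansion_unique_complex has_fps_expansion_cong by metis
  have "F - fps_const (of_real a) * F * fps_X = F * (1 - fps_const (of_real a) * fps_X)"
    by (simp only: right_diff_distrib mult_1_right mult_ac)
  then have eq': "F - fps_const (of_real a) * F * fps_X = fps_const (of_real a) - fps_X"
    by (simp only: eq)
  have rec: "fps_nth F (Suc n) = of_real a * fps_nth F n - (if n = 0 then 1 else 0)" for n
  proof -
    have "fps_nth F (Suc n) - of_real a * fps_nth F n = - (if n = 0 then 1 else 0)"
      using arg_cong[OF eq', of "\<lambda>G. fps_nth G (Suc n)"] by simp
    then show ?thesis by (simp add: diff_eq_eq)
  qed
  have F0: "fps_nth F 0 = of_real a" by (simp add: F_def fps_expansion_def extremal_f_def)
  have "fps_nth F (Suc k) = - of_real ((1 - a\<^sup>2) * a ^ k)"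
  proof (induction k)
    case 0
    show ?case using rec[of 0] by (simp add: F0 power2_eq_square)
  next
    case (Suc k)
    then show ?case using rec[of "Suc k"] by (simp add: mult_ac)
  qed
  then show ?thesis by (simp add: taylor_coeff_def F_def)
qed

text \<open>At z = -1/3 the Schwarz--Pick bound is attained, and the coefficient moduli (1 - a^2)
  a^k sum to exactly the bounds used for the majorant and the area.\<close>

lemma bohr_M_extremal:
  assumes a: "0 \<le> a" "a < 1"
  shows "bohr_M (extremal_f a) (- 1 / 3) (1 / 3) = ((3 * a + 1) / (3 + a))\<^sup>2 + (1 - a\<^sup>2) / (3 - a)
      + 16 / 9 * (9 * (1 - a\<^sup>2)\<^sup>2 / (9 - a\<^sup>2)\<^sup>2)
      + lambda_of crit_a * (9 * (1 - a\<^sup>2)\<^sup>2 / (9 - a\<^sup>2)\<^sup>2)\<^sup>2"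
proof -
  have a2: "a\<^sup>2 < 1" using a by (simp add: abs_square_less_1)
  have coeff: "cmod (taylor_coeff (extremal_f a) (Suc k)) = (1 - a\<^sup>2) * a ^ k" for k
    unfolding taylor_coeff_extremal[OF a] norm_minus_cancel norm_of_real using a a2 by simp
  have "extremal_f a (- 1 / 3) = of_real ((3 * a + 1) / (3 + a))"
  proof -
    have "(a + 1 / 3) / (1 + a / 3) = (3 * a + 1) / (3 + a)" using a by (simp add: field_simps)
    moreover have "extremal_f a (- 1 / 3) = of_real ((a + 1 / 3) / (1 + a / 3))"
      by (simp add: extremal_f_def)
    ultimately show ?thesis by simp
  qed
  then have val: "cmod (extremal_f a (- 1 / 3)) = (3 * a + 1) / (3 + a)"
    using a by (simp only: norm_of_real) simp
  have "(\<lambda>k. (1 - a\<^sup>2) / 3 * (a / 3) ^ k) sums ((1 - a\<^sup>2) / 3 * (1 / (1 - a / 3)))"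
    using a by (intro sums_mult geometric_sums) auto
  moreover have "(1 - a\<^sup>2) / 3 * (1 / (1 - a / 3)) = (1 - a\<^sup>2) / (3 - a)"
    using a by (simp add: field_simps)
  ultimately have B: "(\<Sum>k. cmod (taylor_coeff (extremal_f a) (Suc k)) * (1 / 3) ^ Suc k) = (1 - a\<^sup>2) / (3 - a)"
    unfolding coeff by (simp add: sums_iff power_divide field_simps)
  have "(\<lambda>k. (1 - a\<^sup>2)\<^sup>2 / 9 * (of_nat (Suc k) * (a\<^sup>2 / 9) ^ k)) sums ((1 - a\<^sup>2)\<^sup>2 / 9 * (1 / (1 - a\<^sup>2 / 9)\<^sup>2))"
    using a2 by (intro sums_mult geometric_deriv_sums) auto
  moreover have "(1 - a\<^sup>2)\<^sup>2 / 9 * (of_nat (Suc k) * (a\<^sup>2 / 9) ^ k) =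
      real (Suc k) * ((1 - a\<^sup>2) * a ^ k)\<^sup>2 * (1 / 3) ^ (2 * Suc k)" for k
  proof -
    have "(1 / 3 :: real) ^ (2 * Suc k) = 1 / 9 * (1 / 9) ^ k"
      unfolding power_mult by (simp add: power2_eq_square)
    moreover have "(a\<^sup>2 / 9) ^ k = (a ^ k)\<^sup>2 * (1 / 9) ^ k"
      by (simp add: power_divide mult.commute flip: power_mult)
    ultimately show ?thesis by (simp add: power_mult_distrib)
  qed
  moreover have "(1 - a\<^sup>2)\<^sup>2 / 9 * (1 / (1 - a\<^sup>2 / 9)\<^sup>2) = 9 * (1 - a\<^sup>2)\<^sup>2 / (9 - a\<^sup>2)\<^sup>2"
  proof -
    have "1 - a\<^sup>2 / 9 = (9 - a\<^sup>2) / 9" by simp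
    then show ?thesis using a2 by (simp only: power_divide) simp
  qed
  ultimately have S: "image_area (extremal_f a) (1 / 3) / pi = 9 * (1 - a\<^sup>2)\<^sup>2 / (9 - a\<^sup>2)\<^sup>2"
    unfolding image_area_def coeff by (simp only: sums_iff) simp
  show ?thesis unfolding bohr_M_def B S val ..
qed

theorem theorem2:
  shows "(\<exists>!t::real. 0 < t \<and> t < 1 \<and> crit_poly t = 0)
    \<and> \<bar>crit_a - 0.537869\<bar> < 0.0000005
    \<and> \<bar>lambda_of crit_a - 16.4618\<bar> < 0.00005
    \<and> (\<forall>f. f analytic_on ball 0 1 \<and> (\<forall>z\<in>ball 0 1. cmod (f z) \<le> 1) \<longrightarrow>
          (\<forall>z r. cmod z = r \<and> r \<le> 1 / 3 \<longrightarrow> bohr_M f z r \<le> 1))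
    \<and> extremal_f crit_a analytic_on ball 0 1
    \<and> (\<forall>z\<in>ball 0 1. cmod (extremal_f crit_a z) \<le> 1)
    \<and> (\<exists>z r. cmod z = r \<and> r \<le> 1 / 3 \<and> bohr_M (extremal_f crit_a) z r = 1)"
proof (intro conjI allI impI ballI)
  show "\<exists>!t::real. 0 < t \<and> t < 1 \<and> crit_poly t = 0" by (rule crit_poly_unique_root)
  show "\<bar>crit_a - 0.537869\<bar> < 0.0000005" using crit_a_bounds by (simp add: abs_less_iff)
  show "\<bar>lambda_of crit_a - 16.4618\<bar> < 0.00005" using lambda_bounds unfolding abs_less_iff by simp
  show "bohr_M f z r \<le> 1"
    if f: "f analytic_on ball 0 1 \<and> (\<forall>z\<in>ball 0 1. cmod (f z) \<le> 1)" and z: "cmod z = r \<and> r \<le> 1 / 3"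
    for f z r
  proof -
    interpret unit_bounded f "cmod (f 0)"
      by unfold_locales (use f in \<open>auto simp: analytic_imp_holomorphic\<close>)
    show ?thesis using z by (intro bohr_M_le_1) auto
  qed
  show "extremal_f crit_a analytic_on ball 0 1"
    using extremal_holomorphic[of crit_a] crit_a_root by (simp add: analytic_on_open)
  show "cmod (extremal_f crit_a z) \<le> 1" if "z \<in> ball 0 1" for z
    using norm_extremal_le_1[of crit_a z] crit_a_root that by simp
  have "bohr_M (extremal_f crit_a) (- 1 / 3) (1 / 3) = 1"
    using bohr_M_extremal[of crit_a] extremal_value_crit crit_a_root by simp
  then show "\<exists>z r. cmod z = r \<and> r \<le> 1 / 3 \<and> bohr_M (extremal_f crit_a) z r = 1"
    by (intro exI[of _ "- 1 / 3"] exI[of _ "1 / 3"]) (simp add: norm_divide)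
qed

end
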